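(* Suppose that colocating multiple servers at the same site is allowed, so that a placement is a multiset $L$ of $p$ sites of $\mathcal I$. Let $i^*\in\arg\min_{i\in\mathcal I}\sum_{j\in\mathcal J}\lambda_j(\tau_i+t_{ij})$ be a $1$-Median location. Then as $\theta\to\infty$ the optimal solution of the $p$-Hypercube problem with arrival rates $\lambda_j(\theta)=\theta\lambda_j$ is to place all $p$ units at the $1$-Median location; that is, the placement with all $p$ units at $i^*$ minimizes the heavy-load limit $\lim_{\theta\to\infty}\mathrm{OPT}_H(\theta,L)$ over all multisets $L$ of $p$ sites.
   Context: $p$-Hypercube model with colocation. $\mathcal I=\{1,\dots,N\}$ are candidate sites, $\mathcal J=\{1,\dots,M\}$ subregions. A unit located at site $i$ serving subregion $j$ has mean service time $1/\mu_{ij}$; $\tau_i$ is the turnout time at site $i$ and $t_{ij}$ the travel time from $i$ to $j$; $\lambda_j$ is the base arrival rate of (Poisson) calls from subregion $j$, and for $\theta>0$ the arrival rates are $\lambda_j(\theta)=\theta\lambda_j$. There are $p$ units $u=1,\dots,p$; under placement $L$ unit $u$ is at site $s(u)\in\mathcal I$, where $L$ is the multiset $\{s(1),\dots,s(p)\}$. For every subregion $j$ there is a predetermined preference list ranking the $p$ units: $\gamma_{jl}$ is the $l$-th preferred unit for $j$, $\eta_{uj}$ is the rank of unit $u$, and $G_{uk}$ is the set of subregions for which unit $u$ is the $k$-th preferred. A call is assigned to the highest-ranked available unit and is lost if no unit is available. For $0\le r\le p-1$ the correction factor is $$Q(p,\bar\rho,r)=\sum_{k=r}^{p-1}\frac{\binom{k}{r}}{\binom{p}{r}}\,\frac{p-k}{p-r}\,\frac{P(k)}{\bar\rho^{\,r}(1-\bar\rho)},$$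 where $P(k)=\frac{a^k/k!}{\sum_{n=0}^{p}a^n/n!}$ is the Erlang-loss probability that exactly $k$ of $p$ servers are busy, with $a$ the offered load giving average server utilization $\bar\rho=a(1-P(p))/p$ (value at $\bar\rho=0$ by continuity). The utilizations $\rho_u=\rho_u(\theta;L)$ solve $$\rho_u=1-\Big(1+\sum_{k=1}^{p}\sum_{j\in G_{uk}}\frac{\theta\lambda_j\,Q(p,\bar\rho,k-1)\prod_{l=1}^{k-1}\rho_{\gamma_{jl}}}{\mu_{s(u)j}}\Big)^{-1},\qquad \bar\rho=\sum_{j\in\mathcal J}\frac{\theta\lambda_j}{p}\sum_{u=1}^{p}\frac{q_{uj}(\theta;L)}{\mu_{s(u)j}},$$ with $q_{uj}(\theta;L)=Q(p,\bar\rho,\eta_{uj}-1)\big(\prod_{l=1}^{\eta_{uj}-1}\rho_{\gamma_{jl}}\big)(1-\rho_u)$. The objective (system-wide mean response time) at scale $\theta$ is $$\mathrm{OPT}_H(\theta,L)=\sum_{u=1}^{p}\sum_{j\in\mathcal J}(\tau_{s(u)}+t_{s(u)j})\,\frac{\lambda_j}{\sum_{j'\in\mathcal J}\lambda_{j'}}\,\frac{q_{uj}(\theta;L)}{\sum_{u'=1}^{p}q_{u'j}(\theta;L)}.$$ *)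

theory Defs
  imports Complex_Main "HOL-Library.Multiset"
begin

text \<open>Sites, subregions and units are the indices \<open>{1..num_sites}\<close>, \<open>{1..num_regions}\<close>
  and \<open>{1..num_units}\<close>; the first argument of \<open>travel\<close> and \<open>mu\<close> is the site.
  The field \<open>mu\<close> is a service rate: mean service times are \<open>1 / mu i j\<close>.\<close>

record hypercube_model =
  num_sites :: nat
  num_regions :: nat
  num_units :: nat
  turnout :: "nat \<Rightarrow> real"
  travel :: "nat \<Rightarrow> nat \<Rightarrow> real"
  mu :: "nat \<Rightarrow> nat \<Rightarrow> real"
  lam :: "nat \<Rightarrow> real"

abbreviation sites :: "hypercube_model \<Rightarrow> nat set" where
  "sites H \<equiv> {1..num_sites H}"

abbreviation regions :: "hypercube_model \<Rightarrow> nat set" where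
  "regions H \<equiv> {1..num_regions H}"

abbreviation units :: "hypercube_model \<Rightarrow> nat set" where
  "units H \<equiv> {1..num_units H}"

definition valid_model :: "hypercube_model \<Rightarrow> bool" where
  "valid_model H \<longleftrightarrow>
     num_units H \<ge> 1 \<and>
     (\<forall>i\<in>sites H. \<forall>j\<in>regions H. mu H i j > 0) \<and>
     (\<forall>j\<in>regions H. lam H j \<ge> 0) \<and>
     (\<Sum>j\<in>regions H. lam H j) > 0"

definition one_medians :: "hypercube_model \<Rightarrow> nat set" where
  "one_medians H =
     {i. is_arg_min (\<lambda>i. \<Sum>j\<in>regions H. lam H j * (turnout H i + travel H i j))
           (\<lambda>i. i \<in> sites H) i}"

definition placements :: "hypercube_model \<Rightarrow> nat multiset set" where
  "placements H = {L. size L = num_units H \<and> set_mset L \<subseteq> sites H}"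

text \<open>A labelling \<open>s\<close> of a placement by units: unit \<open>u\<close> is at site \<open>s u\<close>.\<close>

definition unit_sites :: "hypercube_model \<Rightarrow> nat multiset \<Rightarrow> (nat \<Rightarrow> nat) \<Rightarrow> bool" where
  "unit_sites H L s \<longleftrightarrow> image_mset s (mset_set (units H)) = L"

text \<open>\<open>\<gamma> j l\<close> is the \<open>l\<close>-th preferred unit for subregion \<open>j\<close>, ranks starting at 1.\<close>

definition preference_lists :: "hypercube_model \<Rightarrow> (nat \<Rightarrow> nat \<Rightarrow> nat) \<Rightarrow> bool" where
  "preference_lists H \<gamma> \<longleftrightarrow> (\<forall>j\<in>regions H. bij_betw (\<gamma> j) (units H) (units H))"

definition unit_rank :: "hypercube_model \<Rightarrow> (nat \<Rightarrow> nat \<Rightarrow> nat) \<Rightarrow> nat \<Rightarrow> nat \<Rightarrow> nat" where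
  "unit_rank H \<gamma> u j = the_inv_into (units H) (\<gamma> j) u"

definition pref_regions :: "hypercube_model \<Rightarrow> (nat \<Rightarrow> nat \<Rightarrow> nat) \<Rightarrow> nat \<Rightarrow> nat \<Rightarrow> nat set" where
  "pref_regions H \<gamma> u k = {j \<in> regions H. \<gamma> j k = u}"

text \<open>Erlang-loss probability that exactly \<open>k\<close> of \<open>p\<close> servers are busy at offered load \<open>a\<close>.\<close>

definition erlang_prob :: "nat \<Rightarrow> real \<Rightarrow> nat \<Rightarrow> real" where
  "erlang_prob p a k = (a ^ k / fact k) / (\<Sum>n=0..p. a ^ n / fact n)"

definition offered_load :: "nat \<Rightarrow> real \<Rightarrow> real" where
  "offered_load p \<rho> = (THE a. a \<ge> 0 \<and> \<rho> = a * (1 - erlang_prob p a p) / real p)"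

definition corr_formula :: "nat \<Rightarrow> real \<Rightarrow> nat \<Rightarrow> real" where
  "corr_formula p \<rho> r =
     (\<Sum>k\<in>{r..<p}. real (k choose r) / real (p choose r) * (real (p - k) / real (p - r))
        * (erlang_prob p (offered_load p \<rho>) k / (\<rho> ^ r * (1 - \<rho>))))"

text \<open>The correction factor \<open>Q\<close>. At \<open>\<rho> = 0\<close> the formula is an expression 0/0 when
  \<open>r \<ge> 1\<close>, and \<open>Q\<close> is its continuous extension.\<close>

definition corr_factor :: "nat \<Rightarrow> real \<Rightarrow> nat \<Rightarrow> real" where
  "corr_factor p \<rho> r =
     (if \<rho> = 0 then Lim (at_right 0) (\<lambda>x. corr_formula p x r) else corr_formula p \<rho> r)"

definition assign_prob ::
  "hypercube_model \<Rightarrow> (nat \<Rightarrow> nat \<Rightarrow> nat) \<Rightarrow> (nat \<Rightarrow> real) \<Rightarrow> real \<Rightarrow> nat \<Rightarrow> nat \<Rightarrow> real" where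
  "assign_prob H \<gamma> \<rho> \<rho>bar u j =
     corr_factor (num_units H) \<rho>bar (unit_rank H \<gamma> u j - 1)
       * (\<Prod>l\<in>{1..<unit_rank H \<gamma> u j}. \<rho> (\<gamma> j l)) * (1 - \<rho> u)"

text \<open>\<open>\<rho>\<close> and \<open>\<rho>bar\<close> solve the utilization equations at scale \<open>\<theta>\<close>. The range conditions
  say that the unknowns are utilizations and that \<open>\<rho>bar\<close> is in the domain of \<open>Q\<close>, since no
  finite offered load gives average utilization 1.\<close>

definition utilization_solution ::
  "hypercube_model \<Rightarrow> (nat \<Rightarrow> nat) \<Rightarrow> (nat \<Rightarrow> nat \<Rightarrow> nat) \<Rightarrow> real \<Rightarrow> (nat \<Rightarrow> real) \<Rightarrow> real \<Rightarrow> bool" where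
  "utilization_solution H s \<gamma> \<theta> \<rho> \<rho>bar \<longleftrightarrow>
     (\<forall>u\<in>units H. 0 \<le> \<rho> u \<and> \<rho> u \<le> 1) \<and> 0 \<le> \<rho>bar \<and> \<rho>bar < 1 \<and>
     (\<forall>u\<in>units H.
        \<rho> u = 1 - inverse (1 + (\<Sum>k=1..num_units H. \<Sum>j\<in>pref_regions H \<gamma> u k.
          \<theta> * lam H j * corr_factor (num_units H) \<rho>bar (k - 1)
            * (\<Prod>l\<in>{1..<k}. \<rho> (\<gamma> j l)) / mu H (s u) j))) \<and>
     \<rho>bar = (\<Sum>j\<in>regions H. \<theta> * lam H j / real (num_units H)
               * (\<Sum>u\<in>units H. assign_prob H \<gamma> \<rho> \<rho>bar u j / mu H (s u) j))"

text \<open>System-wide mean response time. It depends on the scale \<open>\<theta>\<close> only through the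
  utilizations \<open>\<rho>\<close> and \<open>\<rho>bar\<close>, as the factor \<open>\<theta>\<close> cancels in the subregion weights.\<close>

definition mean_response_time ::
  "hypercube_model \<Rightarrow> (nat \<Rightarrow> nat) \<Rightarrow> (nat \<Rightarrow> nat \<Rightarrow> nat) \<Rightarrow> (nat \<Rightarrow> real) \<Rightarrow> real \<Rightarrow> real" where
  "mean_response_time H s \<gamma> \<rho> \<rho>bar =
     (\<Sum>u\<in>units H. \<Sum>j\<in>regions H.
        (turnout H (s u) + travel H (s u) j)
        * (lam H j / (\<Sum>j'\<in>regions H. lam H j'))
        * (assign_prob H \<gamma> \<rho> \<rho>bar u j / (\<Sum>u'\<in>units H. assign_prob H \<gamma> \<rho> \<rho>bar u' j)))"

end

theory Submission
  imports Defs
begin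

text \<open>In heavy traffic the correction factors tend to 1 and every unit is saturated, so unit \<open>u\<close>
  is idle with probability asymptotic to \<open>1 / (\<theta> W u)\<close>, where
  \<open>W u = (\<Sum>j. lam j / mu (s u) j)\<close>, and \<open>\<theta> q u j\<close> tends to \<open>1 / W u\<close> for every \<open>j\<close>.
  The limiting share of the calls of subregion \<open>j\<close> served by unit \<open>u\<close> therefore does not
  depend on \<open>j\<close>, and the limit of the objective is a convex combination of the 1-median
  costs of the occupied sites.

  Saturation is shown along the preference list of one subregion with positive demand: once
  the units of rank below \<open>k\<close> are saturated, the demand reaching the unit of rank \<open>k\<close> grows
  linearly in \<open>\<theta>\<close>. This needs the correction factor to stay away from 0, which holds as soon
  as the average utilization does.\<close>

subsection \<open>Carried load of the Erlang loss system\<close>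

text \<open>The load that is not lost, which is the mean number of busy servers.
  \<open>offered_load p\<close> inverts \<open>carried_load p a / real p\<close>.\<close>

definition carried_load :: "nat \<Rightarrow> real \<Rightarrow> real" where
  "carried_load p a = a * (1 - erlang_prob p a p)"

lemma erlang_norm_pos: "a \<ge> 0 \<Longrightarrow> (\<Sum>n=0..p. a ^ n / fact n :: real) > 0"
  by (subst sum.atLeast_Suc_atMost) (auto intro!: add_pos_nonneg sum_nonneg)

lemma erlang_prob_nonneg: "a \<ge> 0 \<Longrightarrow> erlang_prob p a k \<ge> 0"
  using erlang_norm_pos[of a p] by (simp add: erlang_prob_def less_imp_le)

lemma sum_erlang_prob: "a \<ge> 0 \<Longrightarrow> (\<Sum>k=0..p. erlang_prob p a k) = 1"
  unfolding erlang_prob_def sum_divide_distrib[symmetric]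
  using erlang_norm_pos[of a p] by simp

lemma erlang_prob_last_le_1: "a \<ge> 0 \<Longrightarrow> erlang_prob p a p \<le> 1"
  using sum_erlang_prob[of a p] member_le_sum[of p "{0..p}" "erlang_prob p a"] erlang_prob_nonneg[of a p]
  by simp

lemma carried_load_0 [simp]: "carried_load 0 a = 0"
  by (simp add: carried_load_def erlang_prob_def)

lemma carried_load_at_0 [simp]: "carried_load p 0 = 0"
  by (simp add: carried_load_def)

text \<open>The factor 1 - P(p + 1) removes exactly the top term from the normalizing sum.\<close>

lemma carried_load_Suc_eq:
  assumes "a \<ge> 0"
  shows "carried_load (Suc p) a * (\<Sum>n=0..Suc p. a ^ n / fact n) = a * (\<Sum>n=0..p. a ^ n / fact n)"
proof -
  have "erlang_prob (Suc p) a (Suc p) * (\<Sum>n=0..Suc p. a ^ n / fact n) = a ^ Suc p / fact (Suc p)"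
    using erlang_norm_pos[OF assms, of "Suc p"] unfolding erlang_prob_def
    by (simp del: sum.atLeast0_atMost_Suc power_Suc fact_Suc)
  hence "(1 - erlang_prob (Suc p) a (Suc p)) * (\<Sum>n=0..Suc p. a ^ n / fact n) = (\<Sum>n=0..p. a ^ n / fact n)"
    by (simp add: left_diff_distrib)
  thus ?thesis by (simp add: carried_load_def mult.assoc)
qed

lemma carried_load_le: "a \<ge> 0 \<Longrightarrow> carried_load p a \<le> a"
  using erlang_prob_nonneg[of a p p] by (simp add: carried_load_def mult_left_le)

lemma carried_load_nonneg: "a \<ge> 0 \<Longrightarrow> carried_load p a \<ge> 0"
  using erlang_prob_last_le_1[of a p] by (simp add: carried_load_def)

text \<open>The Erlang recursion, written for the carried load; all monotonicity and range statements
  follow from it by induction.\<close>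

lemma carried_load_Suc:
  assumes "a \<ge> 0"
  shows "carried_load (Suc p) a = real (Suc p) * a / (real (Suc p) + a - carried_load p a)"
proof -
  define D where "D = (\<lambda>p. \<Sum>n=0..p. a ^ n / fact n)"
  have pos: "D n > 0" for n using erlang_norm_pos[OF assms] by (simp add: D_def)
  have den: "real (Suc p) + a - carried_load p a > 0"
    using carried_load_le[OF assms, of p] by simp
  have "carried_load p a = a * (1 - (a ^ p / fact p) / D p)"
    by (simp add: carried_load_def erlang_prob_def D_def)
  \<comment> \<open>The lost load times the normalizing sum is \<open>a\<close> times its top term,
    and this is p + 1 times the next term of the series.\<close>
  hence "(a - carried_load p a) * D p = a * (a ^ p / fact p)"
    using pos[of p] by (simp add: field_simps)
  also have "\<dots> = real (Suc p) * (D (Suc p) - D p)"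
    by (simp add: D_def divide_simps del: of_nat_Suc)
  finally have 1: "(real (Suc p) + a - carried_load p a) * D p = real (Suc p) * D (Suc p)"
    by (simp add: algebra_simps)
  have 2: "carried_load (Suc p) a * D (Suc p) = a * D p"
    using carried_load_Suc_eq[OF assms] by (simp add: D_def)
  have "carried_load (Suc p) a * (real (Suc p) + a - carried_load p a) * D p
     = carried_load (Suc p) a * ((real (Suc p) + a - carried_load p a) * D p)" by simp
  also have "\<dots> = real (Suc p) * (carried_load (Suc p) a * D (Suc p))" unfolding 1 by simp
  also have "\<dots> = real (Suc p) * a * D p" unfolding 2 by simp
  finally have "carried_load (Suc p) a * (real (Suc p) + a - carried_load p a) = real (Suc p) * a"
    using pos[of p] by simp
  thus ?thesis using den by (simp add: field_simps)
qed

lemma carried_load_le_units: "a \<ge> 0 \<Longrightarrow> carried_load p a \<le> real p"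
proof (induction p)
  case (Suc p)
  hence "real (Suc p) * a \<le> real (Suc p) * (real (Suc p) + a - carried_load p a)"
    by (intro mult_left_mono) auto
  thus ?case using Suc carried_load_le[of a p]
    by (simp add: carried_load_Suc pos_divide_le_eq del: of_nat_Suc)
qed simp

lemma carried_load_less_units:
  assumes "a \<ge> 0" "p \<ge> 1" shows "carried_load p a < real p"
proof -
  obtain q where q: "p = Suc q" using assms(2) by (cases p) auto
  have "real (Suc q) * a < real (Suc q) * (real (Suc q) + a - carried_load q a)"
    using carried_load_le_units[OF assms(1), of q] by (intro mult_strict_left_mono) auto
  thus ?thesis using carried_load_le[OF assms(1), of q] assms(1)
    by (simp add: q carried_load_Suc pos_divide_less_eq del: of_nat_Suc)
qed

text \<open>Dropping the carried load of p - 1 servers from the denominator in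
  \<open>carried_load_Suc\<close> gives this bound. It tends to p for large \<open>a\<close>, so
  every utilization below 1 is attained.\<close>

lemma carried_load_lower:
  assumes "a \<ge> 0" "p \<ge> 1" shows "carried_load p a \<ge> real p * a / (real p + a)"
proof -
  obtain q where q: "p = Suc q" using assms(2) by (cases p) auto
  show ?thesis unfolding q carried_load_Suc[OF assms(1)]
    using carried_load_nonneg[OF assms(1), of q] carried_load_le[OF assms(1), of q] assms(1)
    by (intro divide_left_mono) auto
qed

text \<open>In the cross-multiplied recursion the products of \<open>a\<close> and \<open>b\<close>
  cancel. What remains follows from \<open>a \<le> b\<close> and the induction hypothesis, the
  differences to p + 1 being nonnegative by \<open>carried_load_le_units\<close>.\<close>

lemma carried_load_mono:
  assumes "0 \<le> a" "a \<le> b" shows "carried_load p a \<le> carried_load p b"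
  using assms
proof (induction p)
  case (Suc p)
  have "a * (real (Suc p) - carried_load p b) \<le> b * (real (Suc p) - carried_load p a)"
    using Suc carried_load_le_units[of b p] by (intro mult_mono) auto
  hence "real (Suc p) * (a * (real (Suc p) + b - carried_load p b))
      \<le> real (Suc p) * (b * (real (Suc p) + a - carried_load p a))"
    by (intro mult_left_mono) (simp_all add: algebra_simps)
  moreover have "real (Suc p) + a - carried_load p a > 0" "real (Suc p) + b - carried_load p b > 0"
    using carried_load_le[of a p] carried_load_le[of b p] Suc.prems by auto
  ultimately show ?case using Suc.prems
    by (simp add: carried_load_Suc divide_simps mult.assoc del: of_nat_Suc)
qed simp

text \<open>One step of the recursion turns \<open>a < b\<close> into strictness, as q servers carry
  less than q + 1; \<open>carried_load_mono\<close> for q servers handles the rest.\<close>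

lemma carried_load_strict_mono:
  assumes "0 \<le> a" "a < b" "p \<ge> 1" shows "carried_load p a < carried_load p b"
proof -
  obtain q where q: "p = Suc q" using assms(3) by (cases p) auto
  have "a * (real (Suc q) - carried_load q b) \<le> a * (real (Suc q) - carried_load q a)"
    using carried_load_mono[of a b q] assms by (intro mult_left_mono) auto
  also have "\<dots> < b * (real (Suc q) - carried_load q a)"
    using assms carried_load_le_units[of a q] by (intro mult_strict_right_mono) auto
  finally have "a * (real (Suc q) - carried_load q b) < b * (real (Suc q) - carried_load q a)" .
  hence "real (Suc q) * (a * (real (Suc q) + b - carried_load q b))
      < real (Suc q) * (b * (real (Suc q) + a - carried_load q a))"
    by (intro mult_strict_left_mono) (simp_all add: algebra_simps)
  moreover have "real (Suc q) + a - carried_load q a > 0" "real (Suc q) + b - carried_load q b > 0"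
    using carried_load_le[of a q] carried_load_le[of b q] assms by auto
  ultimately show ?thesis unfolding q using assms
    by (simp add: carried_load_Suc divide_simps mult.assoc del: of_nat_Suc)
qed

section \<open>Inverting the carried load: \<open>offered_load\<close> and its limits\<close>

lemma continuous_on_erlang_prob: "continuous_on {0..} (\<lambda>a. erlang_prob p a k)"
  unfolding erlang_prob_def
proof (rule continuous_on_divide)
  show "\<forall>a\<in>{0..}. (\<Sum>n=0..p. a ^ n / fact n :: real) \<noteq> 0"
    using less_imp_neq[OF erlang_norm_pos, symmetric] by auto
qed (auto intro!: continuous_intros)

lemma continuous_on_carried_load: "continuous_on {0..} (carried_load p)"
  unfolding carried_load_def by (intro continuous_intros continuous_on_erlang_prob)

lemma carried_load_surj:
  assumes "0 \<le> x" "x < 1" "p \<ge> 1"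
  shows "\<exists>a\<ge>0. carried_load p a = real p * x"
proof -
  \<comment> \<open>\<open>b\<close> is the load at which the bound of
    \<open>carried_load_lower\<close> equals p * x; the intermediate value theorem is applied
    between 0 and \<open>b\<close>.\<close>
  define b where "b = real p * x / (1 - x)"
  have b: "b \<ge> 0" using assms by (simp add: b_def)
  have "real p * b / (real p + b) = real p * x"
    using assms by (simp add: b_def divide_simps) (simp add: algebra_simps)
  hence "real p * x \<le> carried_load p b"
    using carried_load_lower[OF b assms(3)] by simp
  thus ?thesis
    using IVT'[of "carried_load p" 0 "real p * x" b] b assms
      continuous_on_subset[OF continuous_on_carried_load[of p], of "{0..b}"]
    by auto
qed

text \<open>The definite description has exactly one solution: existence is
  \<open>carried_load_surj\<close>, uniqueness is strict monotonicity.\<close>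

lemma offered_load:
  assumes "0 \<le> x" "x < 1" "p \<ge> 1"
  shows offered_load_nonneg: "offered_load p x \<ge> 0"
    and carried_offered_load: "carried_load p (offered_load p x) = real p * x"
proof -
  have eq: "(\<rho> = a * (1 - erlang_prob p a p) / real p) = (carried_load p a = real p * \<rho>)" for \<rho> a
    using assms(3) by (auto simp: carried_load_def field_simps)
  have "\<exists>!a. a \<ge> 0 \<and> carried_load p a = real p * x"
    using carried_load_surj[OF assms] carried_load_strict_mono[OF _ _ assms(3)]
    by (metis less_irrefl linorder_neqE)
  from theI'[OF this] show "offered_load p x \<ge> 0" "carried_load p (offered_load p x) = real p * x"
    unfolding offered_load_def eq by auto
qed

lemma offered_load_less_iff:
  assumes "0 \<le> x" "x < 1" "p \<ge> 1" "b \<ge> 0"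
  shows "offered_load p x < b \<longleftrightarrow> real p * x < carried_load p b"
    and "b < offered_load p x \<longleftrightarrow> carried_load p b < real p * x"
  using offered_load[OF assms(1-3)] carried_load_mono[of _ _ p] carried_load_strict_mono[OF _ _ assms(3)]
    assms(4) by (metis not_less)+

text \<open>Every offered load e > 0 carries a positive load, which keeps
  \<open>offered_load p x\<close> below e for small x. The one-sided target filter matches the
  continuity of the Erlang probabilities on \<open>{0..}\<close>.\<close>

lemma filterlim_offered_load_at_0:
  assumes "p \<ge> 1"
  shows "filterlim (offered_load p) (at_right 0) (at_right 0)"
proof -
  have "eventually (\<lambda>x. 0 < offered_load p x \<and> offered_load p x < e) (at_right 0)" if "e > 0" for e
  proof -
    have "carried_load p e > 0"
      using carried_load_strict_mono[of 0 e p] that assms by simp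
    hence "eventually (\<lambda>x. x \<in> {0<..<min 1 (carried_load p e / real p)}) (at_right (0::real))"
      using assms by (intro eventually_at_right_real) simp
    thus ?thesis
      by eventually_elim (use that assms offered_load_less_iff[where b = 0] in
        \<open>auto simp: offered_load_less_iff(1) pos_less_divide_eq mult.commute\<close>)
  qed
  note * = this
  have "(offered_load p \<longlongrightarrow> 0) (at_right 0)"
  proof (rule order_tendstoI)
    fix e :: real assume "e < 0"
    with *[of 1] show "eventually (\<lambda>x. e < offered_load p x) (at_right 0)"
      by (auto elim!: eventually_mono)
  next
    fix e :: real assume "0 < e"
    from *[OF this] show "eventually (\<lambda>x. offered_load p x < e) (at_right 0)"
      by (auto elim!: eventually_mono)
  qed
  moreover from *[of 1] have "eventually (\<lambda>x. offered_load p x \<in> {0<..} \<and> offered_load p x \<noteq> 0) (at_right 0)"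
    by (auto elim!: eventually_mono)
  ultimately show ?thesis unfolding filterlim_at by blast
qed

text \<open>A finite load b carries strictly less than p, so utilizations above
  \<open>carried_load p b / real p\<close> need an offered load beyond b.\<close>

lemma filterlim_offered_load_at_1:
  assumes "p \<ge> 1"
  shows "filterlim (offered_load p) at_top (at_left 1)"
  unfolding filterlim_at_top_dense
proof
  fix Z :: real
  define b where "b = max 0 Z"
  have "carried_load p b / real p < 1"
    using carried_load_less_units[of b p] assms by (simp add: b_def)
  hence "eventually (\<lambda>x. x \<in> {max 0 (carried_load p b / real p)<..<1}) (at_left (1::real))"
    by (intro eventually_at_left_real) simp
  thus "eventually (\<lambda>x. Z < offered_load p x) (at_left 1)"
  proof eventually_elim
    case (elim x)
    have "b \<ge> 0" by (simp add: b_def)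
    hence "b < offered_load p x"
      using elim assms by (simp add: offered_load_less_iff(2) pos_divide_less_eq mult.commute)
    thus ?case by (simp add: b_def)
  qed
qed

subsection \<open>Correction factors\<close>

text \<open>Both sides are the mean number of idle servers: since k a^k / k! = a a^(k-1) / (k-1)!,
  the carried load is the mean number of busy ones.\<close>

lemma idle_units_eq:
  assumes "a \<ge> 0"
  shows "real p - carried_load p a = (\<Sum>k<p. real (p - k) * erlang_prob p a k)"
proof (cases p)
  case (Suc q)
  have "(\<Sum>k=0..p. real k * (a ^ k / fact k)) = a * (\<Sum>n=0..q. a ^ n / fact n)"
    unfolding Suc sum.atLeast0_atMost_Suc_shift
    by (simp add: sum_distrib_left divide_simps del: of_nat_Suc)
  hence "carried_load p a * (\<Sum>n=0..p. a ^ n / fact n) = (\<Sum>k=0..p. real k * (a ^ k / fact k))"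
    unfolding Suc using carried_load_Suc_eq[OF assms, of q] by simp
  hence "carried_load p a = (\<Sum>k=0..p. real k * erlang_prob p a k)"
    unfolding erlang_prob_def times_divide_eq_right sum_divide_distrib[symmetric]
    using erlang_norm_pos[OF assms, of p] by (simp add: eq_divide_eq)
  hence "real p - carried_load p a = (\<Sum>k=0..p. real p * erlang_prob p a k) - (\<Sum>k=0..p. real k * erlang_prob p a k)"
    using sum_erlang_prob[OF assms, of p] by (simp flip: sum_distrib_left)
  also have "\<dots> = (\<Sum>k=0..p. real (p - k) * erlang_prob p a k)"
    by (simp add: of_nat_diff left_diff_distrib flip: sum_subtractf)
  also have "\<dots> = (\<Sum>k<p. real (p - k) * erlang_prob p a k)"
    by (intro sum.mono_neutral_right) auto
  finally show ?thesis .
qed simp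

lemma erlang_prob_eq: "erlang_prob p a k = a ^ k / fact k * erlang_prob p a 0"
  by (simp add: erlang_prob_def)

text \<open>Expresses 1 - x, the factor in the denominator of \<open>corr_formula\<close> that
  vanishes at saturation, by the same Erlang probabilities as the numerator.\<close>

lemma idle_fraction_eq:
  assumes "0 \<le> x" "x < 1" "p \<ge> 1"
  shows "1 - x = (\<Sum>k<p. real (p - k) / real p * erlang_prob p (offered_load p x) k)"
proof -
  have "real p * (1 - x) = (\<Sum>k<p. real (p - k) * erlang_prob p (offered_load p x) k)"
    using idle_units_eq[OF offered_load_nonneg[OF assms], of p] carried_offered_load[OF assms]
    by (simp add: right_diff_distrib)
  also have "\<dots> = real p * (\<Sum>k<p. real (p - k) / real p * erlang_prob p (offered_load p x) k)"
    using assms(3) by (simp add: sum_distrib_left)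
  finally show ?thesis using assms(3) by simp
qed

text \<open>For r = 0 the numerator is the idle fraction itself.\<close>

lemma corr_formula_0:
  assumes "0 \<le> x" "x < 1" "p \<ge> 1"
  shows "corr_formula p x 0 = 1"
proof -
  have "corr_formula p x 0 = (\<Sum>k<p. real (p - k) / real p * erlang_prob p (offered_load p x) k) / (1 - x)"
    by (simp add: corr_formula_def atLeast0LessThan sum_divide_distrib)
  thus ?thesis using assms by (simp only: idle_fraction_eq[OF assms, symmetric]) simp
qed

lemma corr_formula_nonneg:
  assumes "0 \<le> x" "x < 1" "p \<ge> 1"
  shows "corr_formula p x r \<ge> 0"
  unfolding corr_formula_def using assms offered_load_nonneg[OF assms]
  by (intro sum_nonneg mult_nonneg_nonneg divide_nonneg_nonneg erlang_prob_nonneg) auto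

text \<open>The \<open>Lim\<close> in \<open>corr_factor\<close> is meaningful only if the limit
  exists. Writing x as the load a times (1 - P(p)) / p, the factor a^r cancels between P(k), where
  \<open>r \<le> k\<close>, and x^r; the rest is continuous at a = 0.\<close>

lemma corr_formula_tendsto_at_0:
  assumes "p \<ge> 1"
  shows "\<exists>l. ((\<lambda>x. corr_formula p x r) \<longlongrightarrow> l) (at_right 0)"
proof -
  \<comment> \<open>\<open>g\<close> is \<open>corr_formula\<close> as a function of the load after
    this cancellation.\<close>
  define g where "g = (\<lambda>a. \<Sum>k\<in>{r..<p}. real (k choose r) / real (p choose r) * (real (p - k) / real (p - r))
        * (a ^ (k - r) / fact k * erlang_prob p a 0
            / (((1 - erlang_prob p a p) / real p) ^ r * (1 - carried_load p a / real p))))"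
  have P: "((\<lambda>a. erlang_prob p a k) \<longlongrightarrow> erlang_prob p 0 k) (at_right 0)" for k
    using continuous_on_erlang_prob[of p k]
    by (auto simp: continuous_on_def intro: tendsto_within_subset)
  have "(carried_load p \<longlongrightarrow> carried_load p 0) (at_right 0)"
    using continuous_on_carried_load[of p]
    unfolding continuous_on_def by (auto intro: tendsto_within_subset simp del: carried_load_at_0)
  hence C: "(carried_load p \<longlongrightarrow> 0) (at_right 0)" by simp
  \<comment> \<open>At load 0 no call is blocked, so the denominator in \<open>g\<close> tends to (1
    / p)^r, which is not 0.\<close>
  have Pp: "erlang_prob p 0 p = 0" using assms by (simp add: erlang_prob_def)
  define l where "l = (\<Sum>k\<in>{r..<p}. real (k choose r) / real (p choose r) * (real (p - k) / real (p - r))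
        * (0 ^ (k - r) / fact k * erlang_prob p 0 0
            / (((1 - erlang_prob p 0 p) / real p) ^ r * (1 - 0 / real p))))"
  have l: "(g \<longlongrightarrow> l) (at_right 0)"
    unfolding g_def l_def using assms Pp by (intro tendsto_intros P C) auto
  have "((\<lambda>x. g (offered_load p x)) \<longlongrightarrow> l) (at_right 0)"
    using l filterlim_offered_load_at_0[OF assms] by (rule filterlim_compose)
  moreover have "eventually (\<lambda>x. g (offered_load p x) = corr_formula p x r) (at_right 0)"
    using eventually_at_right_real[of 0 "1::real", OF zero_less_one]
  proof eventually_elim
    case (elim x)
    define a where "a = offered_load p x"
    have x: "0 \<le> x" "x < 1" using elim by auto
    have a: "a > 0" using elim assms by (simp add: a_def offered_load_less_iff(2))
    have U: "x = a * ((1 - erlang_prob p a p) / real p)" "carried_load p a / real p = x"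
      using carried_offered_load[OF x assms] assms by (auto simp: a_def carried_load_def field_simps)
    have "a ^ (k - r) / fact k * erlang_prob p a 0 / (((1 - erlang_prob p a p) / real p) ^ r * (1 - x))
        = erlang_prob p a k / (x ^ r * (1 - x))" if "r \<le> k" for k
    proof -
      have "erlang_prob p a k = a ^ r * (a ^ (k - r) / fact k * erlang_prob p a 0)"
        using that by (subst erlang_prob_eq) (simp flip: power_add)
      moreover have "x ^ r = a ^ r * ((1 - erlang_prob p a p) / real p) ^ r"
        by (subst U(1)) (rule power_mult_distrib)
      ultimately show ?thesis using a by simp
    qed
    thus ?case unfolding g_def corr_formula_def U(2) a_def[symmetric]
      by (intro sum.cong refl) simp
  qed
  ultimately have "((\<lambda>x. corr_formula p x r) \<longlongrightarrow> l) (at_right 0)"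
    by (rule Lim_transform_eventually)
  thus ?thesis ..
qed

lemma corr_factor_0:
  assumes "0 \<le> x" "x < 1" "p \<ge> 1"
  shows "corr_factor p x 0 = 1"
proof (cases "x = 0")
  case True
  have "((\<lambda>x. corr_formula p x 0) \<longlongrightarrow> 1) (at_right 0)"
    using eventually_at_right_real[of 0 "1::real", OF zero_less_one]
    by (intro tendsto_eventually) (auto elim!: eventually_mono intro: corr_formula_0 assms(3))
  thus ?thesis using True by (auto simp: corr_factor_def intro!: tendsto_Lim)
qed (use assms in \<open>simp add: corr_factor_def corr_formula_0\<close>)

lemma corr_factor_nonneg:
  assumes "0 \<le> x" "x < 1" "p \<ge> 1"
  shows "corr_factor p x r \<ge> 0"
proof (cases "x = 0")
  case True
  obtain l where l: "((\<lambda>x. corr_formula p x r) \<longlongrightarrow> l) (at_right 0)"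
    using corr_formula_tendsto_at_0[OF assms(3)] by blast
  have "eventually (\<lambda>x. corr_formula p x r \<ge> 0) (at_right 0)"
    using eventually_at_right_real[of 0 "1::real", OF zero_less_one]
    by eventually_elim (auto intro: corr_formula_nonneg assms(3))
  hence "l \<ge> 0" using l by (intro tendsto_lowerbound) auto
  moreover have "Lim (at_right 0) (\<lambda>x. corr_formula p x r) = l"
    using l by (intro tendsto_Lim) auto
  ultimately show ?thesis using True by (simp add: corr_factor_def)
qed (use assms in \<open>simp add: corr_factor_def corr_formula_nonneg\<close>)

section \<open>The correction factor away from utilization 0 and at saturation\<close>

text \<open>By absorption, (p - r) C(p, r) = p C(p - 1, r). The coefficient of the last summand is
  thus the same for all r, which gives all ranks the same limit at saturation.\<close>

lemma corr_coeff_last: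
  assumes "r < p"
  shows "real ((p - 1) choose r) / real (p choose r) * (real (p - (p - 1)) / real (p - r)) = 1 / real p"
proof -
  have "real (p - r) * real (p choose r) = real p * real ((p - 1) choose r)"
    using binomial_absorb_comp[of p r] by (metis of_nat_mult)
  thus ?thesis using assms by (simp add: field_simps)
qed

text \<open>The summand for k = p - 1 suffices. At loads of at least 1/2, P(p - 1) dominates every
  P(k) with k < p up to the constant \<open>K\<close>, hence also 1 - x up to p * K. The threshold 1
  / (2 p) is the mean utilization guaranteed by a single unit that is busy half of the time.\<close>

lemma corr_factor_lower_bound:
  assumes "r < p"
  shows "\<exists>c>0. \<forall>x. 1 / (2 * real p) \<le> x \<and> x < 1 \<longrightarrow> c \<le> corr_factor p x r"
proof (intro exI conjI allI impI)
  \<comment> \<open>\<open>fact (p - 1)\<close> undoes the factorial in P(p - 1);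
    \<open>2 ^ p\<close> pays for raising a^k to a^(p-1) when 2 a is at least 1.\<close>
  define K :: real where "K = fact (p - 1) * 2 ^ p"
  have K: "K > 0" by (simp add: K_def)
  show "1 / (real p * (real p * K)) > 0" using K assms by simp
  fix x :: real assume x: "1 / (2 * real p) \<le> x \<and> x < 1"
  have p: "p \<ge> 1" using assms by simp
  have "0 < 1 / (2 * real p)" using assms by simp
  hence x': "0 < x" "0 \<le> x" "x < 1" using x by linarith+
  define a where "a = offered_load p x"
  have a0: "a \<ge> 0" using offered_load_nonneg[OF x'(2,3) p] by (simp add: a_def)
  have "1 / 2 \<le> real p * x" using x assms by (simp add: field_simps)
  also have "\<dots> \<le> a"
    using carried_load_le[OF a0, of p] carried_offered_load[OF x'(2,3) p] by (simp add: a_def)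
  finally have a: "2 * a \<ge> 1" by simp
  have P: "erlang_prob p a k \<ge> 0" for k by (rule erlang_prob_nonneg[OF a0])
  have bound: "erlang_prob p a k \<le> K * erlang_prob p a (p - 1)" if "k < p" for k
  proof -
    have "a ^ k / fact k \<le> a ^ k" using a0 by (simp add: divide_le_eq mult_le_cancel_left1 fact_ge_1)
    also have "\<dots> \<le> a ^ k * (2 * a) ^ (p - 1 - k)"
      using mult_left_mono[OF one_le_power[OF a], of "a ^ k" "p - 1 - k"] a0 by simp
    also have "\<dots> = 2 ^ (p - 1 - k) * a ^ (p - 1)"
      using that by (simp add: power_mult_distrib flip: power_add)
    also have "\<dots> \<le> 2 ^ p * a ^ (p - 1)"
      using a0 by (intro mult_right_mono power_increasing) auto
    also have "\<dots> = K * (a ^ (p - 1) / fact (p - 1))" by (simp add: K_def)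
    finally have "a ^ k / fact k * erlang_prob p a 0 \<le> K * (a ^ (p - 1) / fact (p - 1)) * erlang_prob p a 0"
      by (intro mult_right_mono P)
    thus ?thesis by (subst (1 2) erlang_prob_eq) (simp add: mult.assoc)
  qed
  have "1 - x = (\<Sum>k<p. real (p - k) / real p * erlang_prob p a k)"
    unfolding a_def by (rule idle_fraction_eq[OF x'(2,3) p])
  also have "\<dots> \<le> (\<Sum>k<p. 1 * (K * erlang_prob p a (p - 1)))"
    using P bound by (intro sum_mono mult_mono) auto
  finally have idle: "1 - x \<le> real p * K * erlang_prob p a (p - 1)" by simp
  have idle': "1 / (real p * K) \<le> erlang_prob p a (p - 1) / (1 - x)"
    using idle x' p K by (simp add: field_simps)
  have "1 / (real p * (real p * K)) \<le> 1 / real p * (erlang_prob p a (p - 1) / (1 - x))"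
    using mult_left_mono[OF idle', of "1 / real p"] by simp
  also have "\<dots> \<le> 1 / real p * (erlang_prob p a (p - 1) / (x ^ r * (1 - x)))"
    using x' P by (intro mult_left_mono divide_left_mono) (auto simp: mult_left_le_one_le power_le_one)
  also have "\<dots> = real ((p - 1) choose r) / real (p choose r) * (real (p - (p - 1)) / real (p - r))
        * (erlang_prob p a (p - 1) / (x ^ r * (1 - x)))"
    unfolding corr_coeff_last[OF assms] ..
  also have "\<dots> \<le> corr_formula p x r"
    unfolding corr_formula_def a_def[symmetric]
    by (rule member_le_sum) (use assms x' P in \<open>auto intro!: mult_nonneg_nonneg divide_nonneg_nonneg\<close>)
  finally show "1 / (real p * (real p * K)) \<le> corr_factor p x r"
    using x' by (simp add: corr_factor_def)
qed

text \<open>As the load grows, P(p - 1) dominates all P(k) with k < p - 1. By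
  \<open>idle_fraction_eq\<close>, where the full system does not occur, 1 - x is then asymptotic to
  P(p - 1) / p.\<close>

lemma erlang_prob_over_idle_tendsto:
  assumes "k < p"
  shows "((\<lambda>x. erlang_prob p (offered_load p x) k / (1 - x)) \<longlongrightarrow> (if k = p - 1 then real p else 0)) (at_left 1)"
proof -
  have p: "p \<ge> 1" using assms by simp
  \<comment> \<open>\<open>w a k\<close> is a^(k - (p - 1)) / k!, proportional to P(k) with a factor
    independent of k; \<open>e\<close> is its limit at infinite load.\<close>
  define w where "w = (\<lambda>a k. inverse (a ^ (p - 1 - k)) / fact k :: real)"
  define e where "e = (\<lambda>k. (if k = p - 1 then 1 else 0) / fact k :: real)"
  have lim: "((\<lambda>a. w a k) \<longlongrightarrow> e k) at_top" if "k < p" for k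
  proof (cases "k = p - 1")
    case False
    hence "filterlim (\<lambda>a::real. a ^ (p - 1 - k)) at_top at_top"
      using that by (intro filterlim_pow_at_top filterlim_ident) auto
    hence "((\<lambda>a::real. inverse (a ^ (p - 1 - k))) \<longlongrightarrow> 0) at_top"
      by (rule tendsto_inverse_0_at_top)
    from tendsto_divide[OF this tendsto_const, of "fact k"] show ?thesis
      using False by (simp add: w_def e_def)
  qed (simp add: w_def e_def)
  define g where "g = (\<lambda>a. w a k / (\<Sum>m<p. real (p - m) / real p * w a m))"
  have "(\<Sum>m<p. real (p - m) / real p * e m) = (\<Sum>m\<in>{p - 1}. real (p - m) / real p * e m)"
    using p by (intro sum.mono_neutral_right) (auto simp: e_def)
  hence den: "(\<Sum>m<p. real (p - m) / real p * e m) = 1 / real p / fact (p - 1)"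
    using p by (simp add: e_def)
  have "(g \<longlongrightarrow> e k / (\<Sum>m<p. real (p - m) / real p * e m)) at_top"
    unfolding g_def
  proof (intro tendsto_divide tendsto_sum tendsto_mult tendsto_const lim)
    show "(\<Sum>m<p. real (p - m) / real p * e m) \<noteq> 0" unfolding den using p by simp
  qed (use assms in auto)
  also have "e k / (\<Sum>m<p. real (p - m) / real p * e m) = (if k = p - 1 then real p else 0)"
    unfolding den by (simp add: e_def)
  finally have "((\<lambda>x. g (offered_load p x)) \<longlongrightarrow> (if k = p - 1 then real p else 0)) (at_left 1)"
    using filterlim_offered_load_at_1[OF p] by (rule filterlim_compose)
  moreover have "eventually (\<lambda>x. g (offered_load p x) = erlang_prob p (offered_load p x) k / (1 - x)) (at_left 1)"
    using eventually_at_left_real[of 0 "1::real", OF zero_less_one]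
  proof eventually_elim
    case (elim x)
    define a where "a = offered_load p x"
    have a: "a > 0" using elim p by (simp add: a_def offered_load_less_iff(2))
    define c where "c = a ^ (p - 1) * erlang_prob p a 0"
    have c: "c \<noteq> 0" using a erlang_norm_pos[of a p] by (simp add: c_def erlang_prob_def)
    have P: "erlang_prob p a m = c * w a m" if "m < p" for m
    proof -
      have "a ^ (p - 1) * inverse (a ^ (p - 1 - m)) = a ^ m"
        using that a by (simp add: field_simps flip: power_add)
      thus ?thesis by (subst erlang_prob_eq) (simp add: c_def w_def)
    qed
    have "1 - x = (\<Sum>m<p. real (p - m) / real p * erlang_prob p a m)"
      unfolding a_def using elim p by (intro idle_fraction_eq) auto
    also have "\<dots> = c * (\<Sum>m<p. real (p - m) / real p * w a m)"
      by (simp add: P sum_distrib_left mult_ac)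
    finally show ?case unfolding a_def[symmetric] P[OF assms] g_def using c by simp
  qed
  ultimately show ?thesis by (rule Lim_transform_eventually)
qed

text \<open>Only the summand k = p - 1 survives: its coefficient is 1 / p, its quotient tends to p,
  and x^r tends to 1.\<close>

lemma corr_factor_tendsto_1:
  assumes "r < p"
  shows "((\<lambda>x. corr_factor p x r) \<longlongrightarrow> 1) (at_left 1)"
proof -
  define co where "co = (\<lambda>k. real (k choose r) / real (p choose r) * (real (p - k) / real (p - r)))"
  have "((\<lambda>x. \<Sum>k\<in>{r..<p}. co k * (erlang_prob p (offered_load p x) k / (1 - x) / x ^ r))
      \<longlongrightarrow> (\<Sum>k\<in>{r..<p}. co k * ((if k = p - 1 then real p else 0) / 1 ^ r))) (at_left 1)"
    by (intro tendsto_intros erlang_prob_over_idle_tendsto) auto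
  also have "(\<Sum>k\<in>{r..<p}. co k * ((if k = p - 1 then real p else 0) / 1 ^ r))
      = (\<Sum>k\<in>{p - 1}. co k * ((if k = p - 1 then real p else 0) / 1 ^ r))"
    using assms by (intro sum.mono_neutral_right) auto
  also have "\<dots> = co (p - 1) * real p" by simp
  also have "co (p - 1) = 1 / real p" unfolding co_def by (rule corr_coeff_last[OF assms])
  also have "1 / real p * real p = 1" using assms by simp
  finally have "((\<lambda>x. corr_formula p x r) \<longlongrightarrow> 1) (at_left 1)"
    by (simp add: corr_formula_def co_def mult.commute)
  moreover have "eventually (\<lambda>x. corr_formula p x r = corr_factor p x r) (at_left 1)"
    using eventually_at_left_real[of 0 "1::real", OF zero_less_one]
    by eventually_elim (simp add: corr_factor_def)
  ultimately show ?thesis by (rule Lim_transform_eventually)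
qed

subsection \<open>Heavy traffic\<close>

lemma unit_rank:
  assumes "preference_lists H \<gamma>" "j \<in> regions H" "u \<in> units H"
  shows unit_rank_in_units: "unit_rank H \<gamma> u j \<in> units H"
    and preferred_unit_rank: "\<gamma> j (unit_rank H \<gamma> u j) = u"
proof -
  have b: "bij_betw (\<gamma> j) (units H) (units H)"
    using assms by (auto simp: preference_lists_def)
  show "unit_rank H \<gamma> u j \<in> units H"
    unfolding unit_rank_def using b assms(3)
    by (intro the_inv_into_into) (auto simp: bij_betw_def)
  show "\<gamma> j (unit_rank H \<gamma> u j) = u"
    unfolding unit_rank_def using f_the_inv_into_f_bij_betw[OF b] assms(3) by simp
qed

lemma unit_rank_preferred:
  assumes "preference_lists H \<gamma>" "j \<in> regions H" "k \<in> units H"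
  shows "unit_rank H \<gamma> (\<gamma> j k) j = k"
  using assms unfolding unit_rank_def preference_lists_def
  by (intro the_inv_into_f_f) (auto simp: bij_betw_def)

text \<open>For a fixed unit each subregion lies in exactly one
  \<open>pref_regions H \<gamma> u k\<close>, the one where k is the rank of the unit. This turns
  the double sum of the utilization equations into a sum over subregions.\<close>

lemma sum_pref_regions:
  assumes "preference_lists H \<gamma>" "u \<in> units H"
  shows "(\<Sum>k=1..num_units H. \<Sum>j\<in>pref_regions H \<gamma> u k. f j k)
       = (\<Sum>j\<in>regions H. f j (unit_rank H \<gamma> u j))"
proof -
  have "(\<Sum>k=1..num_units H. \<Sum>j\<in>pref_regions H \<gamma> u k. f j k)
      = (\<Sum>k=1..num_units H. \<Sum>j\<in>regions H. if \<gamma> j k = u then f j k else 0)"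
    unfolding pref_regions_def by (intro sum.cong refl sum.inter_filter) simp
  also have "\<dots> = (\<Sum>j\<in>regions H. \<Sum>k=1..num_units H. if \<gamma> j k = u then f j k else 0)"
    by (rule sum.swap)
  also have "\<dots> = (\<Sum>j\<in>regions H. f j (unit_rank H \<gamma> u j))"
  proof (intro sum.cong refl)
    fix j assume j: "j \<in> regions H"
    have "(\<Sum>k=1..num_units H. if \<gamma> j k = u then f j k else 0)
        = (\<Sum>k=1..num_units H. if k = unit_rank H \<gamma> u j then f j k else 0)"
      using unit_rank_preferred[OF assms(1) j] preferred_unit_rank[OF assms(1) j assms(2)]
      by (intro sum.cong refl) auto
    also have "\<dots> = f j (unit_rank H \<gamma> u j)"
      using unit_rank_in_units[OF assms(1) j assms(2)] by (simp add: sum.delta')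
    finally show "(\<Sum>k=1..num_units H. if \<gamma> j k = u then f j k else 0) = f j (unit_rank H \<gamma> u j)" .
  qed
  finally show ?thesis .
qed

section \<open>The utilization equations for one fixed placement\<close>

locale heavy_load =
  fixes H :: hypercube_model
    and s :: "nat \<Rightarrow> nat"
    and \<gamma> :: "nat \<Rightarrow> nat \<Rightarrow> nat"
    and \<rho> :: "real \<Rightarrow> nat \<Rightarrow> real"
    and \<rho>bar :: "real \<Rightarrow> real"
  assumes valid: "valid_model H"
    and prefs: "preference_lists H \<gamma>"
    and located: "u \<in> units H \<Longrightarrow> s u \<in> sites H"
    and solution: "\<theta> > 0 \<Longrightarrow> utilization_solution H s \<gamma> \<theta> (\<rho> \<theta>) (\<rho>bar \<theta>)"
begin

abbreviation "p \<equiv> num_units H"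
abbreviation "rank \<equiv> unit_rank H \<gamma>"

text \<open>Times \<theta>, this is the sum in the utilization equation of unit u, grouped by
  subregion. The scale is split off so that a finite positive limit remains.\<close>

definition unit_load :: "real \<Rightarrow> nat \<Rightarrow> real" where
  "unit_load \<theta> u = (\<Sum>j\<in>regions H. lam H j * (corr_factor p (\<rho>bar \<theta>) (rank u j - 1)
      * (\<Prod>l\<in>{1..<rank u j}. \<rho> \<theta> (\<gamma> j l))) / mu H (s u) j)"

text \<open>\<open>unit_load\<close> with all correction factors and utilizations replaced by 1;
  this is \<open>W u\<close> in the overview.\<close>

definition limit_load :: "nat \<Rightarrow> real" where
  "limit_load u = (\<Sum>j\<in>regions H. lam H j / mu H (s u) j)"

text \<open>The idle probabilities are asymptotically inversely proportional to the limit loads;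
  these are the proportions, normalized to sum 1.\<close>

definition limit_share :: "nat \<Rightarrow> real" where
  "limit_share u = inverse (limit_load u) / (\<Sum>v\<in>units H. inverse (limit_load v))"

lemma p_pos: "p \<ge> 1" and mu_pos: "i \<in> sites H \<Longrightarrow> j \<in> regions H \<Longrightarrow> mu H i j > 0"
  and lam_nonneg: "j \<in> regions H \<Longrightarrow> lam H j \<ge> 0"
  and total_lam_pos: "(\<Sum>j\<in>regions H. lam H j) > 0"
  using valid by (auto simp: valid_model_def)

lemma preferred_in_units: "j \<in> regions H \<Longrightarrow> k \<in> units H \<Longrightarrow> \<gamma> j k \<in> units H"
  using prefs by (meson bij_betwE preference_lists_def)

text \<open>One such subregion ranks all units, so its demand alone saturates each of them.\<close>

lemma busy_region: "\<exists>j\<in>regions H. lam H j > 0"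
proof (rule ccontr)
  assume "\<not> ?thesis"
  hence "(\<Sum>j\<in>regions H. lam H j) \<le> 0" by (intro sum_nonpos) (auto simp: not_less)
  thus False using total_lam_pos by simp
qed

context
  fixes \<theta> :: real
  assumes \<theta>: "\<theta> > 0"
begin

lemma util_range: "u \<in> units H \<Longrightarrow> 0 \<le> \<rho> \<theta> u" "u \<in> units H \<Longrightarrow> \<rho> \<theta> u \<le> 1"
  and mean_util_range: "0 \<le> \<rho>bar \<theta>" "\<rho>bar \<theta> < 1"
  using solution[OF \<theta>] by (auto simp: utilization_solution_def)

lemma load_term_nonneg:
  assumes "j \<in> regions H" "u \<in> units H"
  shows "0 \<le> lam H j * (corr_factor p (\<rho>bar \<theta>) (rank u j - 1)
      * (\<Prod>l\<in>{1..<rank u j}. \<rho> \<theta> (\<gamma> j l))) / mu H (s u) j"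
proof -
  have "\<rho> \<theta> (\<gamma> j l) \<ge> 0" if "l \<in> {1..<rank u j}" for l
    using unit_rank_in_units[OF prefs assms] that
    by (intro util_range preferred_in_units assms) auto
  thus ?thesis
    using lam_nonneg[OF assms(1)] mu_pos[OF located[OF assms(2)] assms(1)]
    by (intro divide_nonneg_pos mult_nonneg_nonneg prod_nonneg corr_factor_nonneg mean_util_range p_pos) auto
qed

lemma unit_load_nonneg: "u \<in> units H \<Longrightarrow> unit_load \<theta> u \<ge> 0"
  unfolding unit_load_def by (intro sum_nonneg load_term_nonneg)

lemma idle_eq:
  assumes "u \<in> units H"
  shows "1 - \<rho> \<theta> u = inverse (1 + \<theta> * unit_load \<theta> u)"
proof -
  have "\<rho> \<theta> u = 1 - inverse (1 + (\<Sum>k=1..p. \<Sum>j\<in>pref_regions H \<gamma> u k.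
          \<theta> * lam H j * corr_factor p (\<rho>bar \<theta>) (k - 1) * (\<Prod>l\<in>{1..<k}. \<rho> \<theta> (\<gamma> j l)) / mu H (s u) j))"
    using solution[OF \<theta>] assms unfolding utilization_solution_def by blast
  thus ?thesis unfolding sum_pref_regions[OF prefs assms] unit_load_def
    by (simp add: sum_distrib_left mult.assoc)
qed

text \<open>The equation for \<open>\<rho>bar\<close> only says that it is the average of the \<open>\<rho> u\<close>: the call
  load carried by unit \<open>u\<close> is \<open>(1 - \<rho> u) x = x / (1 + x) = \<rho> u\<close>, where \<open>x\<close> is the sum in
  the equation for \<open>\<rho> u\<close>.\<close>

lemma mean_util_eq: "real p * \<rho>bar \<theta> = (\<Sum>u\<in>units H. \<rho> \<theta> u)"
proof -
  have "\<rho>bar \<theta> = (\<Sum>j\<in>regions H. \<theta> * lam H j / real p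
               * (\<Sum>u\<in>units H. assign_prob H \<gamma> (\<rho> \<theta>) (\<rho>bar \<theta>) u j / mu H (s u) j))"
    using solution[OF \<theta>] unfolding utilization_solution_def by blast
  also have "\<dots> = (\<Sum>j\<in>regions H. \<Sum>u\<in>units H. \<theta> * lam H j / real p
               * (assign_prob H \<gamma> (\<rho> \<theta>) (\<rho>bar \<theta>) u j / mu H (s u) j))"
    by (simp add: sum_distrib_left)
  also have "\<dots> = (\<Sum>u\<in>units H. \<Sum>j\<in>regions H. \<theta> * lam H j / real p
               * (assign_prob H \<gamma> (\<rho> \<theta>) (\<rho>bar \<theta>) u j / mu H (s u) j))"
    by (rule sum.swap)
  also have "\<dots> = (\<Sum>u\<in>units H. (1 - \<rho> \<theta> u) * (\<theta> * unit_load \<theta> u) / real p)"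
    unfolding unit_load_def assign_prob_def sum_distrib_left sum_divide_distrib
    by (intro sum.cong refl) (simp add: mult_ac)
  also have "\<dots> = (\<Sum>u\<in>units H. \<rho> \<theta> u / real p)"
  proof (intro sum.cong refl)
    fix u assume u: "u \<in> units H"
    have "1 + \<theta> * unit_load \<theta> u > 0" using unit_load_nonneg[OF u] \<theta> by (simp add: add_pos_nonneg)
    hence "(1 - \<rho> \<theta> u) * (1 + \<theta> * unit_load \<theta> u) = 1" unfolding idle_eq[OF u] by simp
    hence "(1 - \<rho> \<theta> u) * (\<theta> * unit_load \<theta> u) = \<rho> \<theta> u"
      unfolding distrib_left by simp
    thus "(1 - \<rho> \<theta> u) * (\<theta> * unit_load \<theta> u) / real p = \<rho> \<theta> u / real p" by simp
  qed
  finally have "\<rho>bar \<theta> = (\<Sum>u\<in>units H. \<rho> \<theta> u) / real p" by (simp add: sum_divide_distrib)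
  thus ?thesis using p_pos by (simp add: field_simps)
qed

end

section \<open>Saturation of all units\<close>

lemma util_tendsto_1_of_rank:
  assumes j: "j \<in> regions H" "lam H j > 0" and k: "k \<in> units H"
  shows "((\<lambda>\<theta>. \<rho> \<theta> (\<gamma> j k)) \<longlongrightarrow> 1) at_top"
  using k
proof (induction k rule: less_induct)
  case (less k)
  define u where "u = \<gamma> j k"
  have u: "u \<in> units H" unfolding u_def by (intro preferred_in_units j less.prems)
  have rank: "rank u j = k" unfolding u_def by (intro unit_rank_preferred prefs j less.prems)
  have m: "mu H (s u) j > 0" by (intro mu_pos located u j)
  have IH: "((\<lambda>\<theta>. \<rho> \<theta> (\<gamma> j l)) \<longlongrightarrow> 1) at_top" if "l \<in> {1..<k}" for l
    using that less.prems by (intro less.IH) auto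
  \<comment> \<open>For the first choice the factor is exactly 1, which starts the induction without
    a lower bound on \<open>\<rho>bar\<close>. At later ranks the saturated first choice keeps
    \<open>\<rho>bar\<close> away from 0.\<close>
  have Q: "\<exists>c>0. eventually (\<lambda>\<theta>. c \<le> corr_factor p (\<rho>bar \<theta>) (k - 1)) at_top"
  proof (cases "k = 1")
    case True
    have "eventually (\<lambda>\<theta>. 1 \<le> corr_factor p (\<rho>bar \<theta>) (k - 1)) at_top"
      using eventually_gt_at_top[of 0]
      by eventually_elim (use True corr_factor_0 mean_util_range p_pos in simp)
    thus ?thesis using zero_less_one by blast
  next
    case False
    obtain c where c: "c > 0" "\<And>x. 1 / (2 * real p) \<le> x \<Longrightarrow> x < 1 \<Longrightarrow> c \<le> corr_factor p x (k - 1)"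
      using corr_factor_lower_bound[of "k - 1" p] less.prems by force
    have "eventually (\<lambda>\<theta>. \<rho> \<theta> (\<gamma> j 1) > 1 / 2) at_top"
      using False less.prems by (intro order_tendstoD(1)[OF IH]) auto
    hence "eventually (\<lambda>\<theta>. c \<le> corr_factor p (\<rho>bar \<theta>) (k - 1)) at_top"
      using eventually_gt_at_top[of 0]
    proof eventually_elim
      case (elim \<theta>)
      have "\<gamma> j 1 \<in> units H" using p_pos by (intro preferred_in_units j) auto
      hence "\<rho> \<theta> (\<gamma> j 1) \<le> real p * \<rho>bar \<theta>"
        unfolding mean_util_eq[OF elim(2)] by (intro member_le_sum util_range elim) auto
      hence "1 / (2 * real p) \<le> \<rho>bar \<theta>" using elim(1) p_pos by (simp add: field_simps)
      thus ?case by (intro c mean_util_range elim)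
    qed
    thus ?thesis using c(1) by blast
  qed
  then obtain c where c: "c > 0" "eventually (\<lambda>\<theta>. c \<le> corr_factor p (\<rho>bar \<theta>) (k - 1)) at_top"
    by blast
  have "((\<lambda>\<theta>. \<Prod>l\<in>{1..<k}. \<rho> \<theta> (\<gamma> j l)) \<longlongrightarrow> (\<Prod>l\<in>{1..<k}. 1)) at_top"
    by (intro tendsto_prod IH)
  hence "eventually (\<lambda>\<theta>. (\<Prod>l\<in>{1..<k}. \<rho> \<theta> (\<gamma> j l)) > 1 / 2) at_top"
    by (rule order_tendstoD) simp
  \<comment> \<open>A lower bound for the contribution of subregion \<open>j\<close> alone to
    \<open>unit_load\<close>: the correction factor is at least \<open>c\<close>, the product of
    utilizations at least 1/2.\<close>
  define b where "b = lam H j * (c * (1 / 2)) / mu H (s u) j"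
  have b: "b > 0" using j c m by (simp add: b_def)
  have "eventually (\<lambda>\<theta>. b * \<theta> \<le> 1 + \<theta> * unit_load \<theta> u) at_top"
    using c(2) \<open>eventually (\<lambda>\<theta>. (\<Prod>l\<in>{1..<k}. \<rho> \<theta> (\<gamma> j l)) > 1 / 2) at_top\<close> eventually_gt_at_top[of 0]
  proof eventually_elim
    case (elim \<theta>)
    have "b \<le> lam H j * (corr_factor p (\<rho>bar \<theta>) (rank u j - 1)
        * (\<Prod>l\<in>{1..<rank u j}. \<rho> \<theta> (\<gamma> j l))) / mu H (s u) j"
      unfolding b_def rank using elim c j m
      by (intro divide_right_mono mult_left_mono mult_mono) auto
    also have "\<dots> \<le> unit_load \<theta> u"
      unfolding unit_load_def 
      by (rule member_le_sum[OF j(1)]) (use load_term_nonneg elim u in blast, simp)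
    finally have "b * \<theta> \<le> \<theta> * unit_load \<theta> u" using elim by (simp add: mult.commute)
    thus ?case by simp
  qed
  moreover have "filterlim (\<lambda>\<theta>. b * \<theta>) at_top at_top"
    using b by (intro filterlim_tendsto_pos_mult_at_top[OF tendsto_const] filterlim_ident)
  ultimately have "filterlim (\<lambda>\<theta>. 1 + \<theta> * unit_load \<theta> u) at_top at_top"
    by (rule filterlim_at_top_mono[rotated])
  hence "((\<lambda>\<theta>. inverse (1 + \<theta> * unit_load \<theta> u)) \<longlongrightarrow> 0) at_top"
    by (rule tendsto_inverse_0_at_top)
  hence "((\<lambda>\<theta>. 1 - inverse (1 + \<theta> * unit_load \<theta> u)) \<longlongrightarrow> 1 - 0) at_top"
    by (intro tendsto_intros)
  moreover have "eventually (\<lambda>\<theta>. 1 - inverse (1 + \<theta> * unit_load \<theta> u) = \<rho> \<theta> u) at_top"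
    using eventually_gt_at_top[of 0]
    by eventually_elim (use idle_eq[OF _ u] in force)
  ultimately have "((\<lambda>\<theta>. \<rho> \<theta> u) \<longlongrightarrow> 1 - 0) at_top" by (rule Lim_transform_eventually)
  thus ?case by (simp add: u_def)
qed

lemma util_tendsto_1:
  assumes "u \<in> units H"
  shows "((\<lambda>\<theta>. \<rho> \<theta> u) \<longlongrightarrow> 1) at_top"
proof -
  obtain j where j: "j \<in> regions H" "lam H j > 0" using busy_region by blast
  show ?thesis
    using util_tendsto_1_of_rank[OF j unit_rank_in_units[OF prefs j(1) assms]]
    by (simp add: preferred_unit_rank[OF prefs j(1) assms])
qed

text \<open>An average of utilizations that all tend to 1. The left-sided filter, available as
  \<open>\<rho>bar\<close> stays below 1, is the one in
  \<open>corr_factor_tendsto_1\<close>.\<close>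

lemma mean_util_tendsto_1: "filterlim \<rho>bar (at_left 1) at_top"
proof -
  have "((\<lambda>\<theta>. (\<Sum>u\<in>units H. \<rho> \<theta> u) / real p) \<longlongrightarrow> (\<Sum>u\<in>units H. 1) / real p) at_top"
    using p_pos by (intro tendsto_intros util_tendsto_1) auto
  moreover have "eventually (\<lambda>\<theta>. (\<Sum>u\<in>units H. \<rho> \<theta> u) / real p = \<rho>bar \<theta>) at_top"
    using eventually_gt_at_top[of 0]
    by eventually_elim (use p_pos in \<open>simp only: mean_util_eq[symmetric]\<close>, simp)
  ultimately have "(\<rho>bar \<longlongrightarrow> (\<Sum>u\<in>units H. 1) / real p) at_top" by (rule Lim_transform_eventually)
  moreover have "eventually (\<lambda>\<theta>. \<rho>bar \<theta> \<in> {..<1} \<and> \<rho>bar \<theta> \<noteq> 1) at_top"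
    using eventually_gt_at_top[of 0] by eventually_elim (use mean_util_range in force)
  ultimately show ?thesis using p_pos by (simp add: filterlim_at)
qed

text \<open>Here the preference order disappears: the units ranked before u are saturated in the
  limit and the correction tends to 1, whatever the rank.\<close>

lemma corr_times_prod_tendsto_1:
  assumes "j \<in> regions H" "u \<in> units H"
  shows "((\<lambda>\<theta>. corr_factor p (\<rho>bar \<theta>) (rank u j - 1) * (\<Prod>l\<in>{1..<rank u j}. \<rho> \<theta> (\<gamma> j l))) \<longlongrightarrow> 1) at_top"
proof -
  have r: "1 \<le> rank u j" "rank u j \<le> p" using unit_rank_in_units[OF prefs assms] by auto
  have "((\<lambda>\<theta>. corr_factor p (\<rho>bar \<theta>) (rank u j - 1)) \<longlongrightarrow> 1) at_top"
    using corr_factor_tendsto_1 mean_util_tendsto_1 by (rule filterlim_compose) (use r in simp)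
  moreover have "((\<lambda>\<theta>. \<Prod>l\<in>{1..<rank u j}. \<rho> \<theta> (\<gamma> j l)) \<longlongrightarrow> (\<Prod>l\<in>{1..<rank u j}. 1)) at_top"
    using r by (intro tendsto_prod util_tendsto_1 preferred_in_units assms) auto
  ultimately show ?thesis using tendsto_mult by fastforce
qed

section \<open>Limiting shares and the limit of the objective\<close>

lemma limit_load_pos:
  assumes "u \<in> units H" shows "limit_load u > 0"
proof -
  obtain j where j: "j \<in> regions H" "lam H j > 0" using busy_region by blast
  show ?thesis unfolding limit_load_def
    using j located[OF assms] lam_nonneg mu_pos
    by (intro sum_pos2[of _ j]) (auto intro!: divide_nonneg_pos)
qed

lemma limit_share_nonneg: "u \<in> units H \<Longrightarrow> limit_share u \<ge> 0"
  unfolding limit_share_def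
  by (intro divide_nonneg_nonneg sum_nonneg) (auto intro: less_imp_le[OF limit_load_pos])

lemma sum_inverse_limit_load_pos: "(\<Sum>v\<in>units H. inverse (limit_load v)) > 0"
  using p_pos by (intro sum_pos) (auto intro: limit_load_pos)

lemma sum_limit_share: "(\<Sum>u\<in>units H. limit_share u) = 1"
  unfolding limit_share_def sum_divide_distrib[symmetric]
  using sum_inverse_limit_load_pos by simp

text \<open>By \<open>idle_eq\<close>, \<open>\<theta> * (1 - \<rho> \<theta> u)\<close> is the
  inverse of \<open>inverse \<theta> + unit_load \<theta> u\<close>, so scaling by \<theta> exactly
  offsets the vanishing idle probability.\<close>

lemma scaled_assign_prob_tendsto:
  assumes "j \<in> regions H" "u \<in> units H"
  shows "((\<lambda>\<theta>. \<theta> * assign_prob H \<gamma> (\<rho> \<theta>) (\<rho>bar \<theta>) u j) \<longlongrightarrow> inverse (limit_load u)) at_top"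
proof -
  have "((\<lambda>\<theta>. unit_load \<theta> u) \<longlongrightarrow> (\<Sum>j\<in>regions H. lam H j * 1 / mu H (s u) j)) at_top"
    unfolding unit_load_def using mu_pos[OF located[OF assms(2)]]
    by (intro tendsto_sum tendsto_divide tendsto_mult tendsto_const corr_times_prod_tendsto_1 assms)
       (auto simp: less_imp_neq[symmetric])
  hence "((\<lambda>\<theta>. unit_load \<theta> u) \<longlongrightarrow> limit_load u) at_top" by (simp add: limit_load_def)
  hence "((\<lambda>\<theta>. corr_factor p (\<rho>bar \<theta>) (rank u j - 1) * (\<Prod>l\<in>{1..<rank u j}. \<rho> \<theta> (\<gamma> j l))
      * inverse (inverse \<theta> + unit_load \<theta> u)) \<longlongrightarrow> 1 * inverse (0 + limit_load u)) at_top"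
    using limit_load_pos[OF assms(2)]
    by (intro tendsto_mult tendsto_inverse tendsto_add corr_times_prod_tendsto_1 assms
        tendsto_inverse_0_at_top filterlim_ident) auto
  moreover have "eventually (\<lambda>\<theta>. corr_factor p (\<rho>bar \<theta>) (rank u j - 1) * (\<Prod>l\<in>{1..<rank u j}. \<rho> \<theta> (\<gamma> j l))
      * inverse (inverse \<theta> + unit_load \<theta> u) = \<theta> * assign_prob H \<gamma> (\<rho> \<theta>) (\<rho>bar \<theta>) u j) at_top"
    using eventually_gt_at_top[of 0]
  proof eventually_elim
    case (elim \<theta>)
    have "inverse (inverse \<theta> + unit_load \<theta> u) = inverse (inverse \<theta> * (1 + \<theta> * unit_load \<theta> u))"
      using elim by (simp add: distrib_left)
    also have "\<dots> = \<theta> * (1 - \<rho> \<theta> u)"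
      unfolding idle_eq[OF elim assms(2)] inverse_mult_distrib by simp
    finally show ?case by (simp add: assign_prob_def)
  qed
  ultimately show ?thesis using Lim_transform_eventually by fastforce
qed

text \<open>Numerator and denominator of the assignment quotient both vanish in the limit; expanding
  by \<theta> makes them converge to positive values. As the shares do not depend on j, the sum over
  subregions leaves the 1-median cost of the site of each unit.\<close>

lemma mean_response_time_tendsto:
  "((\<lambda>\<theta>. mean_response_time H s \<gamma> (\<rho> \<theta>) (\<rho>bar \<theta>)) \<longlongrightarrow>
     (\<Sum>u\<in>units H. limit_share u * ((\<Sum>j\<in>regions H. lam H j * (turnout H (s u) + travel H (s u) j))
        / (\<Sum>j\<in>regions H. lam H j)))) at_top"
proof -
  have ratio: "((\<lambda>\<theta>. assign_prob H \<gamma> (\<rho> \<theta>) (\<rho>bar \<theta>) u j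
      / (\<Sum>v\<in>units H. assign_prob H \<gamma> (\<rho> \<theta>) (\<rho>bar \<theta>) v j)) \<longlongrightarrow> limit_share u) at_top"
    if "u \<in> units H" "j \<in> regions H" for u j
  proof -
    have "((\<lambda>\<theta>. \<theta> * assign_prob H \<gamma> (\<rho> \<theta>) (\<rho>bar \<theta>) u j
      / (\<Sum>v\<in>units H. \<theta> * assign_prob H \<gamma> (\<rho> \<theta>) (\<rho>bar \<theta>) v j)) \<longlongrightarrow> limit_share u) at_top"
      unfolding limit_share_def using sum_inverse_limit_load_pos that
      by (intro tendsto_divide tendsto_sum scaled_assign_prob_tendsto) auto
    moreover have "eventually (\<lambda>\<theta>. \<theta> * assign_prob H \<gamma> (\<rho> \<theta>) (\<rho>bar \<theta>) u j
      / (\<Sum>v\<in>units H. \<theta> * assign_prob H \<gamma> (\<rho> \<theta>) (\<rho>bar \<theta>) v j)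
      = assign_prob H \<gamma> (\<rho> \<theta>) (\<rho>bar \<theta>) u j
      / (\<Sum>v\<in>units H. assign_prob H \<gamma> (\<rho> \<theta>) (\<rho>bar \<theta>) v j)) at_top"
      using eventually_gt_at_top[of 0]
      by eventually_elim (simp flip: sum_distrib_left)
    ultimately show ?thesis by (rule Lim_transform_eventually)
  qed
  have "((\<lambda>\<theta>. mean_response_time H s \<gamma> (\<rho> \<theta>) (\<rho>bar \<theta>)) \<longlongrightarrow>
     (\<Sum>u\<in>units H. \<Sum>j\<in>regions H. (turnout H (s u) + travel H (s u) j)
        * (lam H j / (\<Sum>j'\<in>regions H. lam H j')) * limit_share u)) at_top"
    unfolding mean_response_time_def by (intro tendsto_sum tendsto_mult tendsto_const ratio)
  also have "(\<Sum>u\<in>units H. \<Sum>j\<in>regions H. (turnout H (s u) + travel H (s u) j)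
        * (lam H j / (\<Sum>j'\<in>regions H. lam H j')) * limit_share u)
      = (\<Sum>u\<in>units H. limit_share u * ((\<Sum>j\<in>regions H. lam H j * (turnout H (s u) + travel H (s u) j))
        / (\<Sum>j\<in>regions H. lam H j)))"
    by (intro sum.cong refl) (simp add: sum_distrib_left sum_divide_distrib mult_ac)
  finally show ?thesis .
qed

end

section \<open>Comparing the placements with the 1-median\<close>

theorem theorem5:
  fixes H :: hypercube_model
    and i_star :: nat
    and s :: "nat multiset \<Rightarrow> nat \<Rightarrow> nat"
    and \<gamma> :: "nat multiset \<Rightarrow> nat \<Rightarrow> nat \<Rightarrow> nat"
    and \<rho> :: "real \<Rightarrow> nat multiset \<Rightarrow> nat \<Rightarrow> real"
    and \<rho>bar :: "real \<Rightarrow> nat multiset \<Rightarrow> real"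
  assumes "valid_model H"
    and "i_star \<in> one_medians H"
    and "\<And>L. L \<in> placements H \<Longrightarrow> unit_sites H L (s L)"
    and "\<And>L. L \<in> placements H \<Longrightarrow> preference_lists H (\<gamma> L)"
    and "\<And>\<theta> L. \<theta> > 0 \<Longrightarrow> L \<in> placements H \<Longrightarrow>
           utilization_solution H (s L) (\<gamma> L) \<theta> (\<rho> \<theta> L) (\<rho>bar \<theta> L)"
  shows "\<exists>OPT_lim :: nat multiset \<Rightarrow> real.
           (\<forall>L\<in>placements H.
              ((\<lambda>\<theta>. mean_response_time H (s L) (\<gamma> L) (\<rho> \<theta> L) (\<rho>bar \<theta> L))
                 \<longlongrightarrow> OPT_lim L) at_top) \<and>
           is_arg_min OPT_lim (\<lambda>L. L \<in> placements H) (replicate_mset (num_units H) i_star)"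
proof -
  \<comment> \<open>The 1-median objective divided by the positive total demand, which keeps its
    minimizers.\<close>
  define cost where "cost = (\<lambda>i. (\<Sum>j\<in>regions H. lam H j * (turnout H i + travel H i j))
        / (\<Sum>j\<in>regions H. lam H j))"
  define OPT_lim where "OPT_lim = (\<lambda>L. \<Sum>u\<in>units H. heavy_load.limit_share H (s L) u * cost (s L u))"
  have total: "(\<Sum>j\<in>regions H. lam H j) > 0" and p: "num_units H \<ge> 1"
    using assms(1) by (auto simp: valid_model_def)
  have i_star: "i_star \<in> sites H" and cost_min: "\<And>i. i \<in> sites H \<Longrightarrow> cost i_star \<le> cost i"
    using assms(2) total by (auto simp: one_medians_def is_arg_min_def cost_def not_less divide_right_mono)
  have labels: "s L ` units H = set_mset L" if "L \<in> placements H" for L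
    using arg_cong[where f = set_mset, OF assms(3)[OF that, unfolded unit_sites_def]] by simp
  have located: "s L u \<in> sites H" if "L \<in> placements H" "u \<in> units H" for L u
    using labels[OF that(1)] that by (auto simp only: placements_def)
  have heavy: "heavy_load H (s L) (\<gamma> L) (\<lambda>\<theta>. \<rho> \<theta> L) (\<lambda>\<theta>. \<rho>bar \<theta> L)" if L: "L \<in> placements H" for L
    using assms(1) assms(4)[OF L] assms(5)[OF _ L] located[OF L]
    by unfold_locales
  have "cost i_star \<le> OPT_lim L" if L: "L \<in> placements H" for L
  proof -
    interpret heavy_load H "s L" "\<gamma> L" "\<lambda>\<theta>. \<rho> \<theta> L" "\<lambda>\<theta>. \<rho>bar \<theta> L" by (rule heavy[OF L])
    \<comment> \<open>The shares sum to 1, so both sides become averages with the same weights and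
      the costs are compared unit by unit.\<close>
    have "cost i_star = (\<Sum>u\<in>units H. limit_share u * cost i_star)"
      using sum_limit_share by (simp flip: sum_distrib_right)
    also have "\<dots> \<le> OPT_lim L"
      unfolding OPT_lim_def by (intro sum_mono mult_left_mono cost_min located limit_share_nonneg)
    finally show ?thesis .
  qed
  moreover define Ls where "Ls = replicate_mset (num_units H) i_star"
  have Ls: "Ls \<in> placements H" using i_star by (auto simp: Ls_def placements_def)
  moreover have "OPT_lim Ls = cost i_star"
  proof -
    interpret heavy_load H "s Ls" "\<gamma> Ls" "\<lambda>\<theta>. \<rho> \<theta> Ls" "\<lambda>\<theta>. \<rho>bar \<theta> Ls" by (rule heavy[OF Ls])
    \<comment> \<open>All units sit at \<open>i_star\<close>, so the average is the cost of that
      site, whatever the shares.\<close>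
    have "s Ls u = i_star" if "u \<in> units H" for u
    proof -
      have "s Ls u \<in> set_mset Ls" using that by (simp only: labels[OF Ls, symmetric] imageI)
      thus ?thesis by (simp add: Ls_def split: if_splits)
    qed
    thus ?thesis unfolding OPT_lim_def using sum_limit_share by (simp flip: sum_distrib_right)
  qed
  ultimately have "is_arg_min OPT_lim (\<lambda>L. L \<in> placements H) Ls"
    by (auto simp: is_arg_min_def not_less)
  moreover have "((\<lambda>\<theta>. mean_response_time H (s L) (\<gamma> L) (\<rho> \<theta> L) (\<rho>bar \<theta> L)) \<longlongrightarrow> OPT_lim L) at_top"
    if L: "L \<in> placements H" for L
    unfolding OPT_lim_def cost_def by (rule heavy_load.mean_response_time_tendsto[OF heavy[OF L]])
  ultimately show ?thesis unfolding Ls_def by blast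
qed

end
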